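(* Let $H$ be a separable complex Hilbert space with orthonormal basis $\{e_n\}_{n=1}^{\infty}$, and let $S \in B(H)$ be a hyponormal operator with $S e_n = a_n e_{n+1}$ for all $n \ge 1$ (a unilateral weighted shift), where $\{a_n\}_{n=1}^\infty$ is a bounded sequence of positive real numbers. (1) If $0 < a_1 < a_2 < a_3 < \cdots$, then $S$ is near subnormal if and only if $$\sup_{n \ge 1} \left\{ a_n \left( \frac{a_{n+1}^2 - a_n^2}{a_n^2 - a_{n-1}^2} \right)^{\frac12} \right\} < +\infty, \quad \text{where } a_0 = 0.$$ (2) If $0 < a_1 \le a_2 \le a_3 \le \cdots$, then $S$ is near subnormal if and only if there exists some integer $i \ge 1$ such that $0 < a_1 < a_2 < \cdots < a_{i-1} < a_i$ and $a_n = a_i$ for $n = i+1, i+2, \ldots$.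
   Context: $B(H)$ is the algebra of all bounded linear operators on $H$. An operator $A \in B(H)$ is hyponormal if $Q_A := A^*A - AA^* \ge 0$. A hyponormal operator $A$ is called near subnormal if there exists a constant $m > 0$ such that $Q_A \ge m\, A^* Q_A A$.
   Formalization: In (2) it is additionally assumed that a_n = a_{n+1} for some n ≥ 1; without this (2) is false, since the strictly increasing weights a_n = (n/(n+1))^{1/2} give a near subnormal shift whose weights are not eventually constant. *)

theory Defs
  imports "HOL-Analysis.Analysis" "HOL-Library.Complex_Order"
begin

class complex_vector = real_vector +
  fixes scaleC :: "complex \<Rightarrow> 'a \<Rightarrow> 'a" (infixr "*\<^sub>C" 75)
  assumes scaleC_add_right: "c *\<^sub>C (x + y) = c *\<^sub>C x + c *\<^sub>C y"
    and scaleC_add_left: "(c + d) *\<^sub>C x = c *\<^sub>C x + d *\<^sub>C x"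
    and scaleC_scaleC: "c *\<^sub>C d *\<^sub>C x = (c * d) *\<^sub>C x"
    and scaleC_one: "1 *\<^sub>C x = x"
    and scaleR_scaleC: "r *\<^sub>R x = complex_of_real r *\<^sub>C x"

global_interpretation complex_vector: vector_space "scaleC :: complex \<Rightarrow> 'a \<Rightarrow> 'a::complex_vector"
  by unfold_locales
    (simp_all add: scaleC_add_right scaleC_add_left scaleC_scaleC scaleC_one)

(* The inner product is linear in the first and conjugate-linear in the second argument. *)
class complex_inner = complex_vector + real_normed_vector +
  fixes cinner :: "'a \<Rightarrow> 'a \<Rightarrow> complex"
  assumes cinner_commute: "cinner x y = cnj (cinner y x)"
    and cinner_add_left: "cinner (x + y) z = cinner x z + cinner y z"
    and cinner_scaleC_left: "cinner (c *\<^sub>C x) y = c * cinner x y"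
    and cinner_ge_zero: "0 \<le> cinner x x"
    and cinner_eq_zero_iff: "cinner x x = 0 \<longleftrightarrow> x = 0"
    and norm_eq_sqrt_cinner: "norm x = sqrt (Re (cinner x x))"

class complex_hilbert_space = complex_inner + complete_space

definition bounded_clinear :: "('a::complex_inner \<Rightarrow> 'b::complex_inner) \<Rightarrow> bool" where
  "bounded_clinear T \<longleftrightarrow> bounded_linear T \<and> (\<forall>c x. T (c *\<^sub>C x) = c *\<^sub>C T x)"

(* By the Riesz representation theorem this exists for every bounded operator on a Hilbert space;
   uniqueness is immediate from definiteness of the inner product. *)
definition cadjoint :: "('a::complex_hilbert_space \<Rightarrow> 'a) \<Rightarrow> 'a \<Rightarrow> 'a" where
  "cadjoint T = (THE T'. \<forall>x y. cinner (T x) y = cinner x (T' y))"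

(* The order on the complex numbers is the partial one: 0 \<le> z says that z is real
   and nonnegative. *)
definition op_nonneg :: "('a::complex_hilbert_space \<Rightarrow> 'a) \<Rightarrow> bool" where
  "op_nonneg T \<longleftrightarrow> (\<forall>x. 0 \<le> cinner (T x) x)"

definition op_le :: "('a::complex_hilbert_space \<Rightarrow> 'a) \<Rightarrow> ('a \<Rightarrow> 'a) \<Rightarrow> bool" where
  "op_le T U \<longleftrightarrow> op_nonneg (\<lambda>x. U x - T x)"

definition self_commutator :: "('a::complex_hilbert_space \<Rightarrow> 'a) \<Rightarrow> 'a \<Rightarrow> 'a" where
  "self_commutator A = (\<lambda>x. cadjoint A (A x) - A (cadjoint A x))"

definition hyponormal :: "('a::complex_hilbert_space \<Rightarrow> 'a) \<Rightarrow> bool" where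
  "hyponormal A \<longleftrightarrow> bounded_clinear A \<and> op_nonneg (self_commutator A)"

definition near_subnormal :: "('a::complex_hilbert_space \<Rightarrow> 'a) \<Rightarrow> bool" where
  "near_subnormal A \<longleftrightarrow> hyponormal A \<and>
    (\<exists>m>0. op_le (\<lambda>x. m *\<^sub>R cadjoint A (self_commutator A (A x))) (self_commutator A))"

definition orthonormal_basis_on :: "'i set \<Rightarrow> ('i \<Rightarrow> 'a::complex_hilbert_space) \<Rightarrow> bool" where
  "orthonormal_basis_on I e \<longleftrightarrow>
    (\<forall>i\<in>I. \<forall>j\<in>I. cinner (e i) (e j) = (if i = j then 1 else 0)) \<and>
    closure (complex_vector.span (e ` I)) = UNIV"

end

theory Submission
  imports Defs
begin

text \<open>Both \<open>Q = S\<^sup>*S - SS\<^sup>*\<close> and \<open>S\<^sup>*QS\<close> are diagonal in the basis \<open>e\<close>: with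
  \<open>d\<^sub>n = a\<^sub>n\<^sup>2 - a\<^sub>n\<^sub>-\<^sub>1\<^sup>2\<close> one has \<open>Q e\<^sub>n = d\<^sub>n e\<^sub>n\<close> and \<open>S\<^sup>*QS e\<^sub>n = a\<^sub>n\<^sup>2 d\<^sub>n\<^sub>+\<^sub>1 e\<^sub>n\<close>. Hence \<open>S\<close> is near
  subnormal iff \<open>m a\<^sub>n\<^sup>2 d\<^sub>n\<^sub>+\<^sub>1 \<le> d\<^sub>n\<close> for all \<open>n\<close> and some \<open>m > 0\<close>. If all \<open>d\<^sub>n\<close> are positive, divide by
  \<open>d\<^sub>n\<close>; if \<open>d\<^sub>n = 0\<close> for some \<open>n\<close>, then the inequality forces all later \<open>d\<^sub>k\<close> to vanish.\<close>

section \<open>Complex inner product spaces\<close>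

context complex_inner
begin

lemma cinner_add_right: "cinner x (y + z) = cinner x y + cinner x z"
  by (metis cinner_commute cinner_add_left complex_cnj_add)

lemma cinner_scaleC_right: "cinner x (c *\<^sub>C y) = cnj c * cinner x y"
  by (metis cinner_commute cinner_scaleC_left complex_cnj_mult)

lemma cinner_zero_left [simp]: "cinner 0 x = 0"
  using cinner_add_left[of 0 0 x] by simp

lemma cinner_zero_right [simp]: "cinner x 0 = 0"
  using cinner_add_right[of x 0 0] by simp

lemma cinner_diff_left: "cinner (x - y) z = cinner x z - cinner y z"
  using cinner_add_left[of "x - y" y z] by simp

lemma cinner_diff_right: "cinner x (y - z) = cinner x y - cinner x z"
  using cinner_add_right[of x "y - z" z] by simp

lemma cinner_sum_left: "cinner (sum f A) y = (\<Sum>a\<in>A. cinner (f a) y)"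
  by (induction A rule: infinite_finite_induct) (simp_all add: cinner_add_left)

lemma cinner_sum_right: "cinner y (sum f A) = (\<Sum>a\<in>A. cinner y (f a))"
  by (induction A rule: infinite_finite_induct) (simp_all add: cinner_add_right)

lemma cinner_self: "cinner x x = complex_of_real ((norm x)\<^sup>2)"
  using cinner_ge_zero[of x] norm_eq_sqrt_cinner[of x]
  by (simp add: complex_eq_iff less_eq_complex_def)

lemma norm_scaleC: "norm (c *\<^sub>C x) = cmod c * norm x"
proof -
  have "complex_of_real ((norm (c *\<^sub>C x))\<^sup>2) = complex_of_real ((cmod c * norm x)\<^sup>2)"
    unfolding cinner_self[symmetric] power_mult_distrib of_real_mult
    by (simp add: cinner_scaleC_left cinner_scaleC_right complex_norm_square del: of_real_power)
  then show ?thesis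
    by (simp only: of_real_eq_iff) (simp add: power2_eq_iff_nonneg)
qed

lemma Cauchy_Schwarz_cinner: "cmod (cinner x y) \<le> norm x * norm y"
proof (cases "y = 0")
  case False
  then have y: "norm y > 0" by simp
  \<comment> \<open>\<open>c *\<^sub>C y\<close> is the orthogonal projection of \<open>x\<close>
    onto the line through \<open>y\<close>; the inequality is the nonnegativity of the squared norm
    of the remainder.\<close>
  define c where "c = cinner x y / cinner y y"
  have "cinner (x - c *\<^sub>C y) (x - c *\<^sub>C y) = cinner x x - c * cnj (cinner x y)"
    using False
    by (simp add: cinner_diff_left cinner_diff_right cinner_scaleC_left cinner_scaleC_right
        c_def cinner_eq_zero_iff cinner_commute[of y x] field_simps)
  also have "c * cnj (cinner x y) = complex_of_real ((cmod (cinner x y))\<^sup>2 / (norm y)\<^sup>2)"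
    unfolding c_def cinner_self[of y] by (simp add: complex_norm_square del: of_real_power flip: of_real_power)
  finally have "complex_of_real ((norm x)\<^sup>2 - (cmod (cinner x y))\<^sup>2 / (norm y)\<^sup>2) \<ge> 0"
    using cinner_ge_zero[of "x - c *\<^sub>C y"] by (simp add: cinner_self)
  then have "(cmod (cinner x y))\<^sup>2 / (norm y)\<^sup>2 \<le> (norm x)\<^sup>2"
    by (simp add: less_eq_complex_def)
  then have "(cmod (cinner x y))\<^sup>2 \<le> (norm x * norm y)\<^sup>2"
    using y by (simp add: field_simps)
  then show ?thesis
    by (rule power2_le_imp_le) simp
qed simp

lemma cinner_eqI:
  assumes "\<And>x. cinner x y = cinner x z"
  shows "y = z"
  using assms[of "y - z"] cinner_eq_zero_iff[of "y - z"] by (simp add: cinner_diff_right)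

end

lemma bounded_bilinear_cinner: "bounded_bilinear (cinner :: 'a::complex_inner \<Rightarrow> 'a \<Rightarrow> complex)"
proof
  show "\<exists>K. \<forall>a b. norm (cinner (a :: 'a) b) \<le> norm a * norm b * K"
    by (rule exI[of _ 1]) (simp add: Cauchy_Schwarz_cinner)
qed (simp_all add: cinner_add_left cinner_add_right cinner_scaleC_left cinner_scaleC_right
    scaleR_scaleC scaleR_conv_of_real)

lemmas tendsto_cinner = bounded_bilinear.tendsto[OF bounded_bilinear_cinner]
lemmas continuous_on_cinner = bounded_bilinear.continuous_on[OF bounded_bilinear_cinner]

lemma bounded_linear_scaleC: "bounded_linear (scaleC c :: 'a::complex_inner \<Rightarrow> 'a)"
  by (rule bounded_linear_intro[of _ "cmod c"])
    (simp_all add: scaleC_add_right scaleR_scaleC scaleC_scaleC norm_scaleC mult.commute)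

text \<open>Density principle: a condition that cuts out a closed subspace need only be checked on a
  total set such as an orthonormal basis.\<close>

lemma closed_subspace_eq_UNIV:
  fixes W :: "'a::complex_inner set"
  assumes "closure (complex_vector.span B) = UNIV" "complex_vector.subspace W" "closed W" "B \<subseteq> W"
  shows "W = UNIV"
  using assms complex_vector.span_minimal closure_minimal by (metis top.extremum_uniqueI)

section \<open>Adjoints\<close>

lemma bounded_clinear_bounded_linear: "bounded_clinear T \<Longrightarrow> bounded_linear T"
  by (simp add: bounded_clinear_def)

lemma bounded_clinear_add: "bounded_clinear T \<Longrightarrow> T (x + y) = T x + T y"
  by (simp add: bounded_clinear_bounded_linear linear_simps)

lemma bounded_clinear_scaleC: "bounded_clinear T \<Longrightarrow> T (c *\<^sub>C x) = c *\<^sub>C T x"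
  by (simp add: bounded_clinear_def)

lemma bounded_clinear_zero: "bounded_clinear T \<Longrightarrow> T 0 = 0"
  by (simp add: bounded_clinear_bounded_linear linear_simps)

lemma bounded_clinear_sum: "bounded_clinear T \<Longrightarrow> T (sum f A) = (\<Sum>a\<in>A. T (f a))"
  by (induction A rule: infinite_finite_induct)
    (simp_all add: bounded_clinear_add bounded_clinear_zero)

lemma bounded_clinear_compose:
  "bounded_clinear T \<Longrightarrow> bounded_clinear U \<Longrightarrow> bounded_clinear (\<lambda>x. T (U x))"
  by (simp add: bounded_clinear_def bounded_linear_compose)

lemma scaleC_diff_right: "c *\<^sub>C (x - y) = c *\<^sub>C x - c *\<^sub>C (y :: 'a::complex_vector)"
  by (rule complex_vector.scale_right_diff_distrib)

lemma bounded_clinear_diff: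
  "bounded_clinear T \<Longrightarrow> bounded_clinear U \<Longrightarrow> bounded_clinear (\<lambda>x. T x - U x)"
  by (simp add: bounded_clinear_def bounded_linear_sub scaleC_diff_right)

lemma bounded_clinear_scaleR: "bounded_clinear T \<Longrightarrow> bounded_clinear (\<lambda>x. m *\<^sub>R T x)"
  unfolding bounded_clinear_def
  by (auto simp: scaleR_scaleC scaleC_scaleC mult.commute
      intro: bounded_linear_compose[OF bounded_linear_scaleC])

text \<open>Definiteness of the inner product makes a formal adjoint unique, so exhibiting one
  resolves the definite description in \<open>cadjoint\<close>.\<close>

lemma cadjoint_eqI:
  assumes "\<And>x y. cinner (T x) y = cinner x (T' y)"
  shows "cadjoint T = T'"
  unfolding cadjoint_def
proof (rule the_equality)
  fix U assume "\<forall>x y. cinner (T x) y = cinner x (U y)"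
  with assms show "U = T'" by (intro ext cinner_eqI) metis
qed (use assms in blast)

text \<open>Testing the identity at \<open>x = z\<close> turns the squared norm of \<open>z\<close>
  into \<open>cinner (T z) y\<close>, and Cauchy-Schwarz applies. The bound concerns a single
  \<open>y\<close>, so it is available before the adjoint is known to exist everywhere.\<close>

lemma adjoint_norm_le:
  fixes T :: "'a::complex_inner \<Rightarrow> 'a"
  assumes "\<And>x. norm (T x) \<le> norm x * K" "\<And>x. cinner (T x) y = cinner x z"
  shows "norm z \<le> norm y * K"
proof (cases "z = 0")
  case True
  \<comment> \<open>The sign of \<open>K\<close> is not assumed; it comes from the bound on
    \<open>norm (T y)\<close>.\<close>
  have "0 \<le> norm y * K" using assms(1)[of y] norm_ge_zero order_trans by blast
  with True show ?thesis by simp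
next
  case False
  have "(norm z)\<^sup>2 = cmod (cinner (T z) y)" by (simp add: assms(2) cinner_self norm_power)
  also have "\<dots> \<le> norm z * K * norm y"
    using Cauchy_Schwarz_cinner[of "T z" y] assms(1)[of z]
    by (meson mult_right_mono norm_ge_zero order_trans)
  finally show ?thesis using False by (simp add: power2_eq_square mult.assoc mult.commute)
qed

text \<open>The vectors at which the adjoint exists form a closed subspace, so it suffices to find it on a
  total set; this avoids the Riesz representation theorem.\<close>

lemma
  fixes T :: "'a::complex_hilbert_space \<Rightarrow> 'a"
  assumes T: "bounded_clinear T" and total: "closure (complex_vector.span B) = UNIV"
    and B: "\<And>b. b \<in> B \<Longrightarrow> \<exists>z. \<forall>x. cinner (T x) b = cinner x z"
  shows cadjoint_cinner: "cinner (T x) y = cinner x (cadjoint T y)"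
    and bounded_clinear_cadjoint: "bounded_clinear (cadjoint T)"
proof -
  define W where "W = {y. \<exists>z. \<forall>x. cinner (T x) y = cinner x z}"
  obtain K where K: "\<And>x. norm (T x) \<le> norm x * K"
    using bounded_linear.bounded[OF bounded_clinear_bounded_linear[OF T]] by blast
  have "complex_vector.subspace W"
  proof (rule complex_vector.subspaceI)
    show "0 \<in> W" by (auto simp: W_def intro!: exI[of _ 0])
    show "x + y \<in> W" if "x \<in> W" "y \<in> W" for x y
      using that unfolding W_def by (auto simp: cinner_add_right) (metis cinner_add_right)
    show "c *\<^sub>C x \<in> W" if "x \<in> W" for c x
      using that unfolding W_def by (auto simp: cinner_scaleC_right) (metis cinner_scaleC_right)
  qed
  moreover have "closed W"
    unfolding closed_sequential_limits
  proof (intro allI impI, elim conjE)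
    fix s l assume s: "\<forall>n. s n \<in> W" and l: "s \<longlonglongrightarrow> l"
    then obtain z where z: "\<And>n x. cinner (T x) (s n) = cinner x (z n)"
      unfolding W_def by (simp) metis
    \<comment> \<open>The vector \<open>z m - z n\<close> represents \<open>s m - s n\<close>, so
      the norm bound for adjoints shows that \<open>z\<close> inherits the Cauchy property of
      \<open>s\<close>.\<close>
    have dist_le: "norm (z m - z n) \<le> norm (s m - s n) * \<bar>K\<bar>" for m n
    proof -
      have "norm (z m - z n) \<le> norm (s m - s n) * K"
        using K by (rule adjoint_norm_le) (simp add: cinner_diff_right z)
      also have "\<dots> \<le> norm (s m - s n) * \<bar>K\<bar>" by (simp add: mult_left_mono)
      finally show ?thesis .
    qed
    have "Cauchy z"
    proof (rule metric_CauchyI)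
      fix \<epsilon> :: real assume "\<epsilon> > 0"
      then have "\<epsilon> / (\<bar>K\<bar> + 1) > 0" by simp
      then obtain M where M: "\<And>m n. m \<ge> M \<Longrightarrow> n \<ge> M \<Longrightarrow> dist (s m) (s n) < \<epsilon> / (\<bar>K\<bar> + 1)"
        using LIMSEQ_imp_Cauchy[OF l] metric_CauchyD by metis
      have "dist (z m) (z n) < \<epsilon>" if "m \<ge> M" "n \<ge> M" for m n
      proof -
        have "norm (z m - z n) \<le> norm (s m - s n) * (\<bar>K\<bar> + 1)"
          using dist_le[of m n] by (simp add: distrib_left add_increasing2)
        also have "\<dots> < \<epsilon>"
          using M[OF that] by (simp add: dist_norm pos_less_divide_eq)
        finally show ?thesis by (simp add: dist_norm)
      qed
      then show "\<exists>M. \<forall>m\<ge>M. \<forall>n\<ge>M. dist (z m) (z n) < \<epsilon>" by blast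
    qed
    \<comment> \<open>Completeness of the space provides the candidate for the adjoint at the limit
      \<open>l\<close>.\<close>
    then obtain w where w: "z \<longlonglongrightarrow> w" using Cauchy_convergent convergent_def by blast
    have "cinner (T x) l = cinner x w" for x
    proof (rule LIMSEQ_unique)
      show "(\<lambda>n. cinner (T x) (s n)) \<longlonglongrightarrow> cinner (T x) l" by (intro tendsto_cinner tendsto_const l)
      show "(\<lambda>n. cinner (T x) (s n)) \<longlonglongrightarrow> cinner x w"
        unfolding z by (intro tendsto_cinner tendsto_const w)
    qed
    then show "l \<in> W" by (auto simp: W_def)
  qed
  ultimately have "W = UNIV"
    using B by (intro closed_subspace_eq_UNIV[OF total]) (auto simp: W_def)
  then have "\<forall>y. \<exists>z. \<forall>x. cinner (T x) y = cinner x z" by (auto simp: W_def)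
  then obtain T' where T': "\<And>x y. cinner (T x) y = cinner x (T' y)" by metis
  have eq: "cadjoint T = T'" by (rule cadjoint_eqI) (rule T')
  show "cinner (T x) y = cinner x (cadjoint T y)" by (simp add: eq T')
  have scale: "T' (c *\<^sub>C x) = c *\<^sub>C T' x" for c x
    by (rule cinner_eqI) (simp add: cinner_scaleC_right flip: T')
  have "bounded_linear T'"
  proof (rule bounded_linear_intro[of _ K])
    show "T' (x + y) = T' x + T' y" for x y
      by (rule cinner_eqI) (simp add: cinner_add_right flip: T')
    show "norm (T' x) \<le> norm x * K" for x by (rule adjoint_norm_le[OF K T'])
  qed (simp add: scaleR_scaleC scale)
  then show "bounded_clinear (cadjoint T)" by (simp add: eq bounded_clinear_def scale)
qed

section \<open>Diagonal operators\<close>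

text \<open>Basis vectors recover the entries \<open>t i\<close>. Conversely, on finite combinations
  the quadratic form is the sum of the entries weighted by squared moduli of coefficients, and
  continuity carries nonnegativity to the closure. The set where the form is nonnegative is not
  known to be a subspace, so the whole span is treated at once.\<close>

lemma op_nonneg_diagonal_iff:
  fixes T :: "'a::complex_hilbert_space \<Rightarrow> 'a" and t :: "'i \<Rightarrow> real"
  assumes T: "bounded_clinear T" and e: "orthonormal_basis_on I e"
    and diag: "\<And>i. i \<in> I \<Longrightarrow> T (e i) = complex_of_real (t i) *\<^sub>C e i"
  shows "op_nonneg T \<longleftrightarrow> (\<forall>i\<in>I. 0 \<le> t i)"
proof
  have orth: "cinner (e i) (e j) = (if i = j then 1 else 0)" if "i \<in> I" "j \<in> I" for i j
    using e that by (simp add: orthonormal_basis_on_def)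
  show "\<forall>i\<in>I. 0 \<le> t i" if "op_nonneg T"
  proof
    fix i assume i: "i \<in> I"
    have "0 \<le> cinner (T (e i)) (e i)" using that by (simp add: op_nonneg_def)
    then show "0 \<le> t i" by (simp add: diag i orth cinner_scaleC_left less_eq_complex_def)
  qed
  assume t: "\<forall>i\<in>I. 0 \<le> t i"
  let ?W = "{x. 0 \<le> cinner (T x) x}"
  have "closed ?W"
  proof -
    have cont: "continuous_on UNIV (\<lambda>x. cinner (T x) x)"
      using bounded_clinear_bounded_linear[OF T]
      by (intro continuous_on_cinner continuous_on_id linear_continuous_on)
    \<comment> \<open>The order on the complex numbers is partial, so the condition is split into a
      real inequality and a real equation, each of them closed.\<close>
    have "?W = {x. 0 \<le> Re (cinner (T x) x)} \<inter> {x. Im (cinner (T x) x) = 0}"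
      by (auto simp: less_eq_complex_def)
    moreover have "closed \<dots>"
      by (intro closed_Int closed_Collect_le closed_Collect_eq continuous_intros cont)
    ultimately show ?thesis by simp
  qed
  moreover have "complex_vector.span (e ` I) \<subseteq> ?W"
  proof
    fix x assume "x \<in> complex_vector.span (e ` I)"
    then obtain A r where A: "finite A" "A \<subseteq> e ` I" and x: "x = (\<Sum>v\<in>A. r v *\<^sub>C v)"
      unfolding complex_vector.span_explicit mem_Collect_eq by (elim exE conjE) (rule that)
    \<comment> \<open>The combination is indexed by vectors; choosing an index for each of them
      gives access to its diagonal entry.\<close>
    have "\<forall>v\<in>A. \<exists>j. j \<in> I \<and> v = e j" using A(2) by blast
    then obtain i where i: "\<And>v. v \<in> A \<Longrightarrow> i v \<in> I \<and> v = e (i v)"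
      by (rule bchoice[THEN exE]) (auto intro: that)
    have orthA: "cinner v w = (if v = w then 1 else 0)" if "v \<in> A" "w \<in> A" for v w
      using i[OF that(1)] i[OF that(2)] orth by metis
    have "cinner (T x) x = (\<Sum>v\<in>A. \<Sum>w\<in>A. cinner (r v *\<^sub>C T v) (r w *\<^sub>C w))"
      unfolding x bounded_clinear_sum[OF T] bounded_clinear_scaleC[OF T] cinner_sum_left cinner_sum_right
      by (rule sum.swap)
    also have "\<dots> = (\<Sum>v\<in>A. \<Sum>w\<in>A. if w = v then complex_of_real ((cmod (r v))\<^sup>2 * t (i v)) else 0)"
    proof (intro sum.cong refl)
      fix v w assume vw: "v \<in> A" "w \<in> A"
      have "T v = complex_of_real (t (i v)) *\<^sub>C v" using i[OF vw(1)] diag by metis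
      then show "cinner (r v *\<^sub>C T v) (r w *\<^sub>C w) =
          (if w = v then complex_of_real ((cmod (r v))\<^sup>2 * t (i v)) else 0)"
        using orthA[OF vw] by (simp add: cinner_scaleC_left cinner_scaleC_right complex_norm_square mult_ac
            del: of_real_power)
    qed
    also have "\<dots> = complex_of_real (\<Sum>v\<in>A. (cmod (r v))\<^sup>2 * t (i v))"
      using A(1) by simp
    finally have "cinner (T x) x = complex_of_real (\<Sum>v\<in>A. (cmod (r v))\<^sup>2 * t (i v))" .
    moreover have "0 \<le> (\<Sum>v\<in>A. (cmod (r v))\<^sup>2 * t (i v))"
      using i t by (intro sum_nonneg mult_nonneg_nonneg) auto
    ultimately show "x \<in> ?W" by (simp add: less_eq_complex_def del: of_real_sum)
  qed
  ultimately have "closure (complex_vector.span (e ` I)) \<subseteq> ?W" by (rule closure_minimal[rotated])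
  then show "op_nonneg T" using e by (auto simp: op_nonneg_def orthonormal_basis_on_def)
qed

section \<open>Weighted shifts\<close>

text \<open>Once the adjoint is known on the basis, \<open>Q - m S*QS\<close> is diagonal, and its
  positivity becomes a family of scalar inequalities with a common \<open>m\<close>.\<close>

lemma near_subnormal_weighted_shift_iff:
  fixes e :: "nat \<Rightarrow> 'a::complex_hilbert_space" and a :: "nat \<Rightarrow> real"
  assumes basis: "orthonormal_basis_on {1..} e" and hypo: "hyponormal S"
    and shift: "\<And>n. n \<ge> 1 \<Longrightarrow> S (e n) = complex_of_real (a n) *\<^sub>C e (n + 1)"
    and a0: "a 0 = 0"
  shows "near_subnormal S \<longleftrightarrow>
    (\<exists>m>0. \<forall>n\<ge>1. m * ((a n)\<^sup>2 * ((a (n + 1))\<^sup>2 - (a n)\<^sup>2)) \<le> (a n)\<^sup>2 - (a (n - 1))\<^sup>2)"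
proof -
  have S: "bounded_clinear S" using hypo by (simp add: hyponormal_def)
  have total: "closure (complex_vector.span (e ` {1..})) = UNIV"
    and orth: "\<And>i j. i \<ge> 1 \<Longrightarrow> j \<ge> 1 \<Longrightarrow> cinner (e i) (e j) = (if i = j then 1 else 0)"
    using basis by (simp_all add: orthonormal_basis_on_def)
  \<comment> \<open>Since \<open>a 0 = 0\<close>, this gives \<open>S\<^sup>* e\<^sub>1 = 0\<close> whatever the junk vector \<open>e 0\<close> is.\<close>
  have adj: "cinner (S x) (e n) = cinner x (complex_of_real (a (n - 1)) *\<^sub>C e (n - 1))"
    if n: "n \<ge> 1" for n x
  proof -
    let ?z = "complex_of_real (a (n - 1)) *\<^sub>C e (n - 1)"
    let ?W = "{x. cinner (S x) (e n) = cinner x ?z}"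
    \<comment> \<open>Both sides are linear and continuous in \<open>x\<close>, so the identity is
      checked on basis vectors: both sides are \<open>a k\<close> if \<open>n = k + 1\<close> and
      zero otherwise.\<close>
    have "?W = UNIV"
    proof (rule closed_subspace_eq_UNIV[OF total])
      show "complex_vector.subspace ?W"
        by (rule complex_vector.subspaceI)
          (simp_all add: bounded_clinear_zero[OF S] bounded_clinear_add[OF S]
            bounded_clinear_scaleC[OF S] cinner_add_left cinner_scaleC_left)
      show "closed ?W"
        using bounded_clinear_bounded_linear[OF S]
        by (intro closed_Collect_eq continuous_on_cinner continuous_on_id continuous_on_const
            linear_continuous_on)
      have "cinner (S (e k)) (e n) = cinner (e k) ?z" if "k \<ge> 1" for k
      proof (cases "n = 1")
        case True
        with that show ?thesis by (simp add: shift cinner_scaleC_left orth a0)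
      next
        case False
        with that n show ?thesis
          by (auto simp: shift cinner_scaleC_left cinner_scaleC_right orth)
      qed
      then show "e ` {1..} \<subseteq> ?W" by auto
    qed
    then show ?thesis by blast
  qed
  have ex: "\<exists>z. \<forall>x. cinner (S x) b = cinner x z" if "b \<in> e ` {1..}" for b
    using that adj by auto
  have S_adj: "cinner (S x) y = cinner x (cadjoint S y)" for x y
    using S total ex by (rule cadjoint_cinner)
  have S': "bounded_clinear (cadjoint S)"
    using S total ex by (rule bounded_clinear_cadjoint)
  have S'_e: "cadjoint S (e n) = complex_of_real (a (n - 1)) *\<^sub>C e (n - 1)" if "n \<ge> 1" for n
    by (rule cinner_eqI) (simp add: adj[OF that] flip: S_adj)
  define d where "d n = (a n)\<^sup>2 - (a (n - 1))\<^sup>2" for n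
  have Q: "bounded_clinear (self_commutator S)"
    unfolding self_commutator_def
    by (intro bounded_clinear_diff bounded_clinear_compose[OF S S'] bounded_clinear_compose[OF S' S])
  have Q_e: "self_commutator S (e n) = complex_of_real (d n) *\<^sub>C e n" if n: "n \<ge> 1" for n
  proof -
    have "S (cadjoint S (e n)) = complex_of_real ((a (n - 1))\<^sup>2) *\<^sub>C e n"
    \<comment> \<open>The shift relation at index \<open>n - 1\<close> is available only for
      \<open>n\<close> at least 2; for \<open>n = 1\<close> the adjoint already kills
      \<open>e 1\<close>.\<close>
    proof (cases "n = 1")
      case False
      with n show ?thesis
        by (simp add: S'_e shift bounded_clinear_scaleC[OF S] scaleC_scaleC power2_eq_square)
    qed (simp add: S'_e a0 bounded_clinear_zero[OF S])
    moreover have "cadjoint S (S (e n)) = complex_of_real ((a n)\<^sup>2) *\<^sub>C e n"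
      using n by (simp add: S'_e shift bounded_clinear_scaleC[OF S'] scaleC_scaleC power2_eq_square)
    ultimately show ?thesis
      by (simp add: self_commutator_def d_def complex_vector.scale_left_diff_distrib)
  qed
  have "op_le (\<lambda>x. m *\<^sub>R cadjoint S (self_commutator S (S x))) (self_commutator S) \<longleftrightarrow>
      (\<forall>n\<in>{1..}. 0 \<le> d n - m * ((a n)\<^sup>2 * d (n + 1)))" for m
    unfolding op_le_def
  proof (rule op_nonneg_diagonal_iff[OF _ basis])
    show "bounded_clinear (\<lambda>x. self_commutator S x - m *\<^sub>R cadjoint S (self_commutator S (S x)))"
      by (intro bounded_clinear_diff bounded_clinear_scaleR Q
          bounded_clinear_compose[OF S' bounded_clinear_compose[OF Q S]])
    fix n :: nat assume n: "n \<in> {1..}"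
    then have "cadjoint S (self_commutator S (S (e n))) = complex_of_real ((a n)\<^sup>2 * d (n + 1)) *\<^sub>C e n"
      by (simp add: shift Q_e S'_e bounded_clinear_scaleC[OF Q] bounded_clinear_scaleC[OF S']
          scaleC_scaleC power2_eq_square mult_ac)
    with n show "self_commutator S (e n) - m *\<^sub>R cadjoint S (self_commutator S (S (e n))) =
        complex_of_real (d n - m * ((a n)\<^sup>2 * d (n + 1))) *\<^sub>C e n"
      by (simp add: Q_e scaleR_scaleC scaleC_scaleC complex_vector.scale_left_diff_distrib)
  qed
  then show ?thesis using hypo by (simp add: near_subnormal_def d_def Ball_def)
qed

section \<open>Sequences of weights\<close>

text \<open>In the extended reals the supremum always exists, so its finiteness is the same as
  boundedness above by a real number.\<close>

lemma SUP_ereal_less_infinity_iff: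
  "(SUP n\<in>A. ereal (f n)) < \<infinity> \<longleftrightarrow> (\<exists>C. \<forall>n\<in>A. f n \<le> C)"
proof
  assume "(SUP n\<in>A. ereal (f n)) < \<infinity>"
  then obtain k :: nat where k: "(SUP n\<in>A. ereal (f n)) < ereal (real k)"
    using less_PInf_Ex_of_nat by auto
  have "f n \<le> real k" if "n \<in> A" for n
    using SUP_upper[OF that, of "\<lambda>n. ereal (f n)"] k
    by (metis ereal_less_eq(3) less_imp_le order_trans)
  then show "\<exists>C. \<forall>n\<in>A. f n \<le> C" by blast
next
  assume "\<exists>C. \<forall>n\<in>A. f n \<le> C"
  then obtain C where "\<forall>n\<in>A. f n \<le> C" ..
  then have "(SUP n\<in>A. ereal (f n)) \<le> ereal C" by (auto intro: SUP_least)
  then show "(SUP n\<in>A. ereal (f n)) < \<infinity>" using less_ereal.simps(4) le_less_trans by blast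
qed

text \<open>Dividing by \<open>m * q n\<close> and taking square roots turns \<open>m\<close> into
  the bound \<open>sqrt (1 / m)\<close>; squaring reverses this.\<close>

lemma ex_mult_le_iff_bounded_sqrt:
  fixes a p q :: "'i \<Rightarrow> real"
  assumes a: "\<And>n. n \<in> A \<Longrightarrow> 0 < a n" and q: "\<And>n. n \<in> A \<Longrightarrow> 0 < q n"
    and p: "\<And>n. n \<in> A \<Longrightarrow> 0 < p n"
  shows "(\<exists>m>0. \<forall>n\<in>A. m * ((a n)\<^sup>2 * p n) \<le> q n) \<longleftrightarrow> (\<exists>C. \<forall>n\<in>A. a n * sqrt (p n / q n) \<le> C)"
proof
  assume "\<exists>m>0. \<forall>n\<in>A. m * ((a n)\<^sup>2 * p n) \<le> q n"
  then obtain m where m: "m > 0" "\<And>n. n \<in> A \<Longrightarrow> m * ((a n)\<^sup>2 * p n) \<le> q n" by blast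
  have "a n * sqrt (p n / q n) \<le> sqrt (1 / m)" if n: "n \<in> A" for n
  proof -
    have "(a n)\<^sup>2 * (p n / q n) \<le> 1 / m" using m(1) m(2)[OF n] q[OF n] by (simp add: field_simps)
    then have "sqrt ((a n)\<^sup>2 * (p n / q n)) \<le> sqrt (1 / m)" by (rule real_sqrt_le_mono)
    then show ?thesis using a[OF n] by (simp only: real_sqrt_mult real_sqrt_abs abs_of_pos)
  qed
  then show "\<exists>C. \<forall>n\<in>A. a n * sqrt (p n / q n) \<le> C" by blast
next
  assume "\<exists>C. \<forall>n\<in>A. a n * sqrt (p n / q n) \<le> C"
  then obtain C where C: "\<And>n. n \<in> A \<Longrightarrow> a n * sqrt (p n / q n) \<le> C" by blast
  \<comment> \<open>The summand 1 keeps the denominator positive whatever \<open>C\<close>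
    is.\<close>
  have "1 / (C\<^sup>2 + 1) * ((a n)\<^sup>2 * p n) \<le> q n" if n: "n \<in> A" for n
  proof -
    have "(a n)\<^sup>2 * (p n / q n) = (a n * sqrt (p n / q n))\<^sup>2"
      using p[OF n] q[OF n] by (simp add: power_mult_distrib)
    also have "\<dots> \<le> C\<^sup>2" using C[OF n] a[OF n] p[OF n] q[OF n] by (intro power_mono) simp_all
    also have "\<dots> \<le> C\<^sup>2 + 1" by simp
    finally have "(a n)\<^sup>2 * p n \<le> q n * (C\<^sup>2 + 1)" using q[OF n] by (simp add: field_simps)
    then show ?thesis by (simp add: pos_divide_le_eq add_nonneg_pos)
  qed
  moreover have "1 / (C\<^sup>2 + 1) > 0" by (simp add: add_nonneg_pos)
  ultimately show "\<exists>m>0. \<forall>n\<in>A. m * ((a n)\<^sup>2 * p n) \<le> q n" by blast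
qed

text \<open>Each single inequality holds for all small positive \<open>m\<close>, and finitely many
  such thresholds have a positive minimum.\<close>

lemma ex_mult_le_finite:
  fixes p q :: "'i \<Rightarrow> real"
  assumes "finite A" and q: "\<And>n. n \<in> A \<Longrightarrow> 0 < q n"
  shows "\<exists>m>0. \<forall>n\<in>A. m * p n \<le> q n"
  using assms
proof (induction A)
  case empty
  show ?case by (auto intro: exI[of _ 1])
next
  case (insert k A)
  then obtain m where m: "m > 0" "\<And>n. n \<in> A \<Longrightarrow> m * p n \<le> q n" by auto
  \<comment> \<open>The second argument of \<open>min\<close> secures the new inequality at
    \<open>k\<close>; shrinking \<open>m\<close> preserves the old ones, since the right-hand sides
    are positive.\<close>
  define m' where "m' = min m (q k / (\<bar>p k\<bar> + 1))"
  have qk: "q k > 0" using insert.prems by simp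
  have "m' > 0" using m(1) qk by (simp add: m'_def)
  moreover have "m' * p n \<le> q n" if "n \<in> insert k A" for n
  proof (cases "p n \<le> 0")
    case True
    then have "m' * p n \<le> 0" using \<open>m' > 0\<close> by (simp add: mult_nonneg_nonpos)
    also have "0 \<le> q n" using insert.prems[OF that] by simp
    finally show ?thesis .
  next
    case False
    show ?thesis
    proof (cases "n = k")
      case True
      have "m' * p k \<le> q k / (\<bar>p k\<bar> + 1) * (\<bar>p k\<bar> + 1)"
        using False True \<open>m' > 0\<close> qk by (intro mult_mono) (auto simp: m'_def)
      then show ?thesis using True by simp
    next
      case nk: False
      have "m' * p n \<le> m * p n" using False by (intro mult_right_mono) (auto simp: m'_def)
      with m(2)[of n] that nk show ?thesis by simp
    qed
  qed
  ultimately show ?case by blast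
qed

text \<open>After the first equality \<open>a i = a (i + 1)\<close> a vanishing increment forces the
  next one to vanish. Conversely, for \<open>n\<close> at least \<open>i\<close> the left-hand side
  is zero, so only finitely many \<open>n\<close> constrain \<open>m\<close>.\<close>

lemma ex_mult_le_iff_eventually_const:
  fixes a :: "nat \<Rightarrow> real"
  assumes pos: "\<And>n. n \<ge> 1 \<Longrightarrow> 0 < a n" and a0: "a 0 = 0"
    and mono: "\<And>n. n \<ge> 1 \<Longrightarrow> a n \<le> a (n + 1)" and eq: "\<exists>n\<ge>1. a n = a (n + 1)"
  shows "(\<exists>m>0. \<forall>n\<ge>1. m * ((a n)\<^sup>2 * ((a (n + 1))\<^sup>2 - (a n)\<^sup>2)) \<le> (a n)\<^sup>2 - (a (n - 1))\<^sup>2) \<longleftrightarrow>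
    (\<exists>i\<ge>1. (\<forall>n. 1 \<le> n \<and> n < i \<longrightarrow> a n < a (n + 1)) \<and> (\<forall>n\<ge>i + 1. a n = a i))"
proof
  assume "\<exists>m>0. \<forall>n\<ge>1. m * ((a n)\<^sup>2 * ((a (n + 1))\<^sup>2 - (a n)\<^sup>2)) \<le> (a n)\<^sup>2 - (a (n - 1))\<^sup>2"
  then obtain m where m: "m > 0"
    "\<And>n. n \<ge> 1 \<Longrightarrow> m * ((a n)\<^sup>2 * ((a (n + 1))\<^sup>2 - (a n)\<^sup>2)) \<le> (a n)\<^sup>2 - (a (n - 1))\<^sup>2" by blast
  define i where "i = (LEAST n. n \<ge> 1 \<and> a n = a (n + 1))"
  have i: "i \<ge> 1" "a i = a (i + 1)"
    using LeastI_ex[of "\<lambda>n. n \<ge> 1 \<and> a n = a (n + 1)"] eq unfolding i_def by auto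
  have lt: "a n < a (n + 1)" if "1 \<le> n" "n < i" for n
    using not_less_Least[of n "\<lambda>n. n \<ge> 1 \<and> a n = a (n + 1)"] that mono[of n] unfolding i_def by force
  have const: "a n = a (n + 1)" if "n \<ge> i" for n
    using that
  proof (induction n rule: dec_induct)
    case base
    show ?case by (rule i(2))
  next
    case (step n)
    \<comment> \<open>The inequality at \<open>n + 1\<close> has right-hand side zero by the
      induction hypothesis.\<close>
    have "m * ((a (n + 1))\<^sup>2 * ((a (n + 2))\<^sup>2 - (a (n + 1))\<^sup>2)) \<le> 0"
      using m(2)[of "n + 1"] step.IH by simp
    moreover have "0 < m * (a (n + 1))\<^sup>2" using m(1) pos[of "n + 1"] by simp
    ultimately have "(a (n + 2))\<^sup>2 \<le> (a (n + 1))\<^sup>2"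
      by (auto simp: mult_le_0_iff zero_less_mult_iff)
    then have "a (n + 2) \<le> a (n + 1)"
      by (rule power2_le_imp_le) (simp add: pos less_imp_le)
    with mono[of "n + 1"] show ?case by simp
  qed
  have "a n = a i" if "n \<ge> i + 1" for n
    using add_leD1[OF that]
  proof (induction n rule: dec_induct)
    case (step k)
    with const[of k] show ?case by simp
  qed simp
  with i(1) lt show "\<exists>i\<ge>1. (\<forall>n. 1 \<le> n \<and> n < i \<longrightarrow> a n < a (n + 1)) \<and> (\<forall>n\<ge>i + 1. a n = a i)"
    by (intro exI[of _ i]) blast
next
  assume "\<exists>i\<ge>1. (\<forall>n. 1 \<le> n \<and> n < i \<longrightarrow> a n < a (n + 1)) \<and> (\<forall>n\<ge>i + 1. a n = a i)"
  then obtain i where lt: "\<And>n. 1 \<le> n \<Longrightarrow> n < i \<Longrightarrow> a n < a (n + 1)"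
    and const: "\<And>n. n \<ge> i + 1 \<Longrightarrow> a n = a i" by blast
  \<comment> \<open>Monotonicity is given from index 1 on; the step from 0 to 1 rests on
    \<open>a 0 = 0\<close>.\<close>
  have prev: "a (n - 1) \<ge> 0" "a (n - 1) \<le> a n" if "n \<ge> 1" for n
    using that pos[of "n - 1"] mono[of "n - 1"] pos[of n] a0 by (cases "n = 1"; force)+
  have "(a n)\<^sup>2 - (a (n - 1))\<^sup>2 > 0" if "n \<in> {1..<i}" for n
  proof -
    have "a (n - 1) < a n" using that lt[of "n - 1"] pos[of n] a0 by (cases "n = 1") auto
    then show ?thesis using prev[of n] that by (simp add: power_strict_mono)
  qed
  then obtain m where m: "m > 0"
    "\<And>n. n \<in> {1..<i} \<Longrightarrow> m * ((a n)\<^sup>2 * ((a (n + 1))\<^sup>2 - (a n)\<^sup>2)) \<le> (a n)\<^sup>2 - (a (n - 1))\<^sup>2"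
    using ex_mult_le_finite[of "{1..<i}" "\<lambda>n. (a n)\<^sup>2 - (a (n - 1))\<^sup>2"
        "\<lambda>n. (a n)\<^sup>2 * ((a (n + 1))\<^sup>2 - (a n)\<^sup>2)"] by blast
  have "m * ((a n)\<^sup>2 * ((a (n + 1))\<^sup>2 - (a n)\<^sup>2)) \<le> (a n)\<^sup>2 - (a (n - 1))\<^sup>2" if "n \<ge> 1" for n
  proof (cases "n < i")
    case False
    then have "a (n + 1) = a n" using const[of n] const[of "n + 1"] by (cases "n = i") auto
    moreover have "(a (n - 1))\<^sup>2 \<le> (a n)\<^sup>2" using prev[OF that] by (intro power_mono)
    ultimately show ?thesis by simp
  qed (use m(2) that in simp)
  with m(1) show "\<exists>m>0. \<forall>n\<ge>1. m * ((a n)\<^sup>2 * ((a (n + 1))\<^sup>2 - (a n)\<^sup>2)) \<le> (a n)\<^sup>2 - (a (n - 1))\<^sup>2"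
    by blast
qed

text \<open>The second part concerns sequences with at least one equality between neighbours. The
  Bergman weights \<open>sqrt (n / (n + 1))\<close> are strictly increasing and satisfy the
  criterion of the first part, so there near subnormality does not make the weights eventually
  constant.\<close>

theorem theorem1:
  fixes e :: "nat \<Rightarrow> 'a::complex_hilbert_space"
    and S :: "'a \<Rightarrow> 'a"
    and a :: "nat \<Rightarrow> real"
  assumes separable: "separable_space (euclidean :: 'a topology)"
    and basis: "orthonormal_basis_on {1..} e"
    and hypo: "hyponormal S"
    and shift: "\<And>n. n \<ge> 1 \<Longrightarrow> S (e n) = complex_of_real (a n) *\<^sub>C e (n + 1)"
    and bdd: "bounded (a ` {1..})"
    and pos: "\<And>n. n \<ge> 1 \<Longrightarrow> 0 < a n"
    and a0: "a 0 = 0"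
  shows "((\<forall>n\<ge>1. a n < a (n + 1)) \<longrightarrow>
           (near_subnormal S \<longleftrightarrow>
             (SUP n\<in>{1..}. ereal (a n * sqrt (((a (n + 1))\<^sup>2 - (a n)\<^sup>2) / ((a n)\<^sup>2 - (a (n - 1))\<^sup>2)))) < \<infinity>)) \<and>
         ((\<forall>n\<ge>1. a n \<le> a (n + 1)) \<and> (\<exists>n\<ge>1. a n = a (n + 1)) \<longrightarrow>
           (near_subnormal S \<longleftrightarrow>
             (\<exists>i\<ge>1. (\<forall>n. 1 \<le> n \<and> n < i \<longrightarrow> a n < a (n + 1)) \<and> (\<forall>n\<ge>i + 1. a n = a i))))"
proof (intro conjI impI)
  have iff: "near_subnormal S \<longleftrightarrow>
      (\<exists>m>0. \<forall>n\<ge>1. m * ((a n)\<^sup>2 * ((a (n + 1))\<^sup>2 - (a n)\<^sup>2)) \<le> (a n)\<^sup>2 - (a (n - 1))\<^sup>2)"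
    using basis hypo shift a0 by (rule near_subnormal_weighted_shift_iff)
  show "near_subnormal S \<longleftrightarrow>
      (SUP n\<in>{1..}. ereal (a n * sqrt (((a (n + 1))\<^sup>2 - (a n)\<^sup>2) / ((a n)\<^sup>2 - (a (n - 1))\<^sup>2)))) < \<infinity>"
    if lt: "\<forall>n\<ge>1. a n < a (n + 1)"
  proof -
    have d: "0 < (a n)\<^sup>2 - (a (n - 1))\<^sup>2" if "n \<ge> 1" for n
    proof (cases "n = 1")
      case False
      then have "a (n - 1) < a n" "0 < a (n - 1)" using lt[rule_format, of "n - 1"] pos[of "n - 1"] that by auto
      then show ?thesis by (simp add: power_strict_mono)
    qed (use pos[of 1] a0 in simp)
    have d': "0 < (a (n + 1))\<^sup>2 - (a n)\<^sup>2" for n using d[of "n + 1"] by simp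
    show ?thesis
      unfolding SUP_ereal_less_infinity_iff
      \<comment> \<open>Here \<open>q n\<close> is the increment of the squared weights at
        \<open>n\<close> and \<open>p n\<close> the one at \<open>n + 1\<close>.\<close>
      by (subst ex_mult_le_iff_bounded_sqrt[symmetric]) (use d d' pos in \<open>auto simp: iff\<close>)
  qed
  show "near_subnormal S \<longleftrightarrow>
      (\<exists>i\<ge>1. (\<forall>n. 1 \<le> n \<and> n < i \<longrightarrow> a n < a (n + 1)) \<and> (\<forall>n\<ge>i + 1. a n = a i))"
    if "(\<forall>n\<ge>1. a n \<le> a (n + 1)) \<and> (\<exists>n\<ge>1. a n = a (n + 1))"
    using that unfolding iff by (intro ex_mult_le_iff_eventually_const pos a0) blast+
qed

end
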